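(* Let $C\in\Bbbk$ and let $X$ be a submultiset of $R_{u+C}$. Then the $\mathcal{S}_u$-module $A_C(X)$ has finite length, bounded above by $\ell(X)+1$.
   Context: $\Bbbk$ is an algebraically closed field of characteristic zero. Fix a nonzero polynomial $g(h)\in\Bbbk[h]$ and a polynomial $u(h)\in\Bbbk[h]$ with $g(h)=u(h-1)-u(h)$ (such $u$ exists, is unique up to its constant term, and $\deg u=\deg g+1\geq 1$). The Smith algebra $\mathcal{S}_u$ is the unital associative $\Bbbk$-algebra generated by $x,y,h$ with defining relations $[h,y]=y$, $[h,x]=-x$, $[y,x]=g(h)$. $R_f$ denotes the multiset of roots of a nonzero polynomial $f$ (with multiplicity). For $C\in\Bbbk$ and a submultiset $X\subseteq R_{u+C}$, put $q(h)=\prod_{\alpha\in X}(h-\alpha)$ (with multiplicity; empty product $=1$) and $p(h)=\frac{u(h-1)+C}{q(h-1)}\in\Bbbk[h]$. The module $A_C(X)$ is $\Bbbk[h]$ with $h$ acting by multiplication and $x\cdot f(h)=f(h+1)q(h)$, $y\cdot f(h)=f(h-1)p(h)$ for all $f\in\Bbbk[h]$. Define a partial order on $\Bbbk$ by $\alpha\preccurlyeq\beta$ iff $\beta-\alpha=n1_\Bbbk$ for some integer $n\geq 0$, and write $\alpha\prec\beta$ if moreover $\alpha\neq\beta$. For a multiset $Z$ of elements of $\Bbbk$, $Z_{\prec\beta}$ is the submultiset $\{\alpha\in Z\mid\alpha\prec\beta\}$, and $|Z|$ is the cardinality counted with multiplicity. For a submultiset $Z\subseteq R_{u+C}$, $\ell(Z)=\sum_{\beta\in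 Z}|(R_{u+C}\setminus Z)_{\prec\beta}|$, where the sum is over $Z$ with multiplicity and $\setminus$ is the multiset difference (with multiplicity). *)

theory Defs
  imports
    "HOL-Computational_Algebra.Polynomial"
    "HOL-Library.Poly_Mapping"
    "HOL-Library.Extended_Nat"
    "HOL-Library.Multiset"
    "HOL-Algebra.QuotRing"
    "HOL-Algebra.Module"
begin

section \<open>Left modules over a not necessarily commutative ring, and their length\<close>

text \<open>The locale \<^locale>\<open>module\<close> of HOL-Algebra demands a commutative ring.\<close>

locale left_module = R?: ring R + M?: abelian_group M
  for R (structure) and M :: "('r, 'm) module" (structure) +
  assumes smult_closed:
      "\<lbrakk>a \<in> carrier R; v \<in> carrier M\<rbrakk> \<Longrightarrow> a \<odot>\<^bsub>M\<^esub> v \<in> carrier M"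
    and smult_l_distr:
      "\<lbrakk>a \<in> carrier R; b \<in> carrier R; v \<in> carrier M\<rbrakk> \<Longrightarrow>
        (a \<oplus>\<^bsub>R\<^esub> b) \<odot>\<^bsub>M\<^esub> v = a \<odot>\<^bsub>M\<^esub> v \<oplus>\<^bsub>M\<^esub> b \<odot>\<^bsub>M\<^esub> v"
    and smult_r_distr:
      "\<lbrakk>a \<in> carrier R; v \<in> carrier M; w \<in> carrier M\<rbrakk> \<Longrightarrow>
        a \<odot>\<^bsub>M\<^esub> (v \<oplus>\<^bsub>M\<^esub> w) = a \<odot>\<^bsub>M\<^esub> v \<oplus>\<^bsub>M\<^esub> a \<odot>\<^bsub>M\<^esub> w"
    and smult_assoc:
      "\<lbrakk>a \<in> carrier R; b \<in> carrier R; v \<in> carrier M\<rbrakk> \<Longrightarrow>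
        (a \<otimes>\<^bsub>R\<^esub> b) \<odot>\<^bsub>M\<^esub> v = a \<odot>\<^bsub>M\<^esub> (b \<odot>\<^bsub>M\<^esub> v)"
    and smult_one:
      "v \<in> carrier M \<Longrightarrow> \<one>\<^bsub>R\<^esub> \<odot>\<^bsub>M\<^esub> v = v"

text \<open>A strict chain \<open>N 0 \<subset> \<dots> \<subset> N n\<close> of submodules has length \<open>n\<close>; the length of a module is the
  supremum of the lengths of these chains, and the module has finite length iff it is finite.
  (\<^locale>\<open>submodule\<close> itself does not involve commutativity of the ring.)\<close>

definition module_length :: "('r, 'x) ring_scheme \<Rightarrow> ('r, 'm) module \<Rightarrow> enat" where
  "module_length R M = (SUP n \<in> {n. \<exists>N :: nat \<Rightarrow> 'm set.
      (\<forall>i\<le>n. submodule (N i) R M) \<and> (\<forall>i<n. N i \<subset> N (Suc i))}. enat n)"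


section \<open>The Smith algebra\<close>

datatype smith_gen = GX | GY | GH

datatype smith_word = Word (letters: "smith_gen list")

text \<open>Words form a monoid under concatenation, written additively so that
  \<^typ>\<open>smith_word \<Rightarrow>\<^sub>0 'k\<close>, with the convolution product of \<^theory>\<open>HOL-Library.Poly_Mapping\<close>,
  is the free unital associative algebra on the three generators.\<close>

instantiation smith_word :: monoid_add
begin
definition "0 = Word []"
definition "v + w = Word (letters v @ letters w)"
instance
  by standard (auto simp: zero_smith_word_def plus_smith_word_def)
end

definition free_gen :: "smith_gen \<Rightarrow> (smith_word \<Rightarrow>\<^sub>0 'k::field)" where
  "free_gen s = Poly_Mapping.single (Word [s]) 1"

abbreviation "free_x \<equiv> free_gen GX"
abbreviation "free_y \<equiv> free_gen GY"
abbreviation "free_h \<equiv> free_gen GH"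

definition free_poly_h :: "'k::field poly \<Rightarrow> (smith_word \<Rightarrow>\<^sub>0 'k)" where
  "free_poly_h g = (\<Sum>i\<le>Polynomial.degree g.
      Poly_Mapping.single 0 (Polynomial.coeff g i) * free_h ^ i)"

definition free_alg :: "(smith_word \<Rightarrow>\<^sub>0 'k::field) ring" where
  "free_alg = \<lparr>carrier = UNIV, mult = (*), one = 1, zero = 0, add = (+)\<rparr>"

definition smith_relators :: "'k::field poly \<Rightarrow> (smith_word \<Rightarrow>\<^sub>0 'k) set" where
  "smith_relators g =
    {(free_h * free_y - free_y * free_h) - free_y,
     (free_h * free_x - free_x * free_h) + free_x,
     (free_y * free_x - free_x * free_y) - free_poly_h g}"

definition smith_ideal :: "'k::field poly \<Rightarrow> (smith_word \<Rightarrow>\<^sub>0 'k) set" where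
  "smith_ideal g = Idl\<^bsub>free_alg\<^esub> (smith_relators g)"

text \<open>The Smith algebra depends on \<open>u\<close> only through \<open>g(h) = u(h - 1) - u(h)\<close>. The scalar
  \<open>c\<close> of the ground field is the class of \<open>Poly_Mapping.single 0 c\<close>, so submodules over this ring
  are automatically subspaces.\<close>

definition smith_algebra :: "'k::field poly \<Rightarrow> (smith_word \<Rightarrow>\<^sub>0 'k) set ring" where
  "smith_algebra g = free_alg Quot smith_ideal g"


section \<open>The modules \<open>A\<^sub>C(X)\<close>\<close>

definition shift_up :: "'k::field poly \<Rightarrow> 'k poly" where
  "shift_up f = pcompose f [:1, 1:]"

definition shift_down :: "'k::field poly \<Rightarrow> 'k poly" where
  "shift_down f = pcompose f [:-1, 1:]"

definition q_poly :: "'k::field multiset \<Rightarrow> 'k poly" where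
  "q_poly X = (\<Prod>\<alpha>\<in>#X. [:-\<alpha>, 1:])"

definition p_poly :: "'k::field poly \<Rightarrow> 'k \<Rightarrow> 'k multiset \<Rightarrow> 'k poly" where
  "p_poly u C X = (shift_down u + [:C:]) div shift_down (q_poly X)"

fun gen_act :: "'k::field poly \<Rightarrow> 'k poly \<Rightarrow> smith_gen \<Rightarrow> 'k poly \<Rightarrow> 'k poly" where
  "gen_act q p GX f = shift_up f * q"
| "gen_act q p GY f = shift_down f * p"
| "gen_act q p GH f = [:0, 1:] * f"

definition word_act :: "'k::field poly \<Rightarrow> 'k poly \<Rightarrow> smith_word \<Rightarrow> 'k poly \<Rightarrow> 'k poly" where
  "word_act q p w f = foldr (gen_act q p) (letters w) f"

definition free_act ::
  "'k::field poly \<Rightarrow> 'k poly \<Rightarrow> (smith_word \<Rightarrow>\<^sub>0 'k) \<Rightarrow> 'k poly \<Rightarrow> 'k poly" where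
  "free_act q p a f =
    (\<Sum>w\<in>Poly_Mapping.keys a. Polynomial.smult (Poly_Mapping.lookup a w) (word_act q p w f))"

text \<open>An element of the Smith algebra is a coset \<open>K\<close>; it acts as any of its representatives.
  Independence of the representative is part of the proof of \<open>A_mod_left_module\<close> below.
  The fields \<open>mult\<close> and \<open>one\<close> are only there because the module record extends the ring record.\<close>

definition A_mod ::
  "'k::field poly \<Rightarrow> 'k \<Rightarrow> 'k multiset \<Rightarrow> ((smith_word \<Rightarrow>\<^sub>0 'k) set, 'k poly) module" where
  "A_mod u C X =
    \<lparr>carrier = UNIV, mult = (*), one = 1, zero = 0, add = (+),
     smult = (\<lambda>K f. the_elem ((\<lambda>a. free_act (q_poly X) (p_poly u C X) a f) ` K))\<rparr>"


section \<open>The number \<open>\<ell>(Z)\<close>\<close>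

definition root_le :: "'k::field_char_0 \<Rightarrow> 'k \<Rightarrow> bool" where
  "root_le \<alpha> \<beta> \<longleftrightarrow> (\<exists>n::nat. \<beta> - \<alpha> = of_nat n)"

definition root_less :: "'k::field_char_0 \<Rightarrow> 'k \<Rightarrow> bool" where
  "root_less \<alpha> \<beta> \<longleftrightarrow> root_le \<alpha> \<beta> \<and> \<alpha> \<noteq> \<beta>"

definition ell :: "'k::field_char_0 poly \<Rightarrow> 'k \<Rightarrow> 'k multiset \<Rightarrow> nat" where
  "ell u C Z = (\<Sum>\<beta>\<in>#Z. size {#\<alpha> \<in># proots (u + [:C:]) - Z. root_less \<alpha> \<beta>#})"


section \<open>\<open>A\<^sub>C(X)\<close> is a module over the Smith algebra\<close>

lemma word_act_zero [simp]: "word_act q p 0 f = f"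
  by (simp add: word_act_def zero_smith_word_def)

lemma word_act_plus: "word_act q p (v + w) f = word_act q p v (word_act q p w f)"
  by (simp add: word_act_def plus_smith_word_def)

lemma gen_act_add: "gen_act q p s (f + f') = gen_act q p s f + gen_act q p s f'"
  by (cases s) (simp_all add: shift_up_def shift_down_def pcompose_add algebra_simps)

lemma gen_act_smult: "gen_act q p s (Polynomial.smult c f) = Polynomial.smult c (gen_act q p s f)"
  by (cases s) (simp_all add: shift_up_def shift_down_def pcompose_smult)

lemma word_act_add: "word_act q p w (f + f') = word_act q p w f + word_act q p w f'"
proof -
  have "foldr (gen_act q p) l (f + f') = foldr (gen_act q p) l f + foldr (gen_act q p) l f'" for l
    by (induction l) (simp_all add: gen_act_add)
  then show ?thesis by (simp add: word_act_def)
qed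

lemma word_act_smult:
  "word_act q p w (Polynomial.smult c f) = Polynomial.smult c (word_act q p w f)"
proof -
  have "foldr (gen_act q p) l (Polynomial.smult c f)
      = Polynomial.smult c (foldr (gen_act q p) l f)" for l
    by (induction l) (simp_all add: gen_act_smult)
  then show ?thesis by (simp add: word_act_def)
qed

lemma free_act_superset:
  assumes "finite S" "Poly_Mapping.keys a \<subseteq> S"
  shows "free_act q p a f =
    (\<Sum>w\<in>S. Polynomial.smult (Poly_Mapping.lookup a w) (word_act q p w f))"
  unfolding free_act_def
  by (rule sum.mono_neutral_left) (use assms in \<open>auto simp: in_keys_iff\<close>)

lemma free_act_plus: "free_act q p (a + b) f = free_act q p a f + free_act q p b f"
proof -
  let ?S = "Poly_Mapping.keys a \<union> Poly_Mapping.keys b"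
  have "finite ?S" by simp
  then show ?thesis
    using free_act_superset[of ?S "a + b" q p f] free_act_superset[of ?S a q p f]
      free_act_superset[of ?S b q p f] Poly_Mapping.keys_add[of a b]
    by (simp add: lookup_add smult_add_left sum.distrib)
qed

lemma free_act_0 [simp]: "free_act q p 0 f = 0"
  by (simp add: free_act_def)

lemma free_act_minus: "free_act q p (- a) f = - free_act q p a f"
  using free_act_plus[of q p a "- a" f] by (simp add: eq_neg_iff_add_eq_0 add.commute)

lemma free_act_diff: "free_act q p (a - b) f = free_act q p a f - free_act q p b f"
  using free_act_plus[of q p a "- b" f] by (simp add: free_act_minus)

lemma free_act_single:
  "free_act q p (Poly_Mapping.single w c) f = Polynomial.smult c (word_act q p w f)"
  by (cases "c = 0") (simp_all add: free_act_def)

lemma free_act_add_right: "free_act q p a (f + f') = free_act q p a f + free_act q p a f'"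
  by (simp add: free_act_def word_act_add smult_add_right sum.distrib)

lemma free_act_sum: "free_act q p (sum F A) f = (\<Sum>i\<in>A. free_act q p (F i) f)"
  by (induction A rule: infinite_finite_induct) (simp_all add: free_act_plus)

lemma poly_mapping_add_induct [case_names single add]:
  fixes a :: "'w \<Rightarrow>\<^sub>0 'k::field"
  assumes single: "\<And>w c. P (Poly_Mapping.single w c)"
    and add: "\<And>a b. P a \<Longrightarrow> P b \<Longrightarrow> P (a + b)"
  shows "P a"
proof (induction a rule: update_induct)
  case const
  show ?case using single[of undefined 0] by simp
next
  case (update a w c)
  then have "Poly_Mapping.update w c a = a + Poly_Mapping.single w c"
    by (intro poly_mapping_eqI)
       (auto simp: lookup_update lookup_add lookup_single in_keys_iff when_def)
  then show ?case using add[OF update.IH single] by simp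
qed

lemma free_act_mult: "free_act q p (a * b) f = free_act q p a (free_act q p b f)"
proof (induction a rule: poly_mapping_add_induct)
  case (single w c)
  show ?case
    by (induction b rule: poly_mapping_add_induct)
       (simp_all add: mult_single free_act_single word_act_plus word_act_smult word_act_add
          distrib_left free_act_plus smult_add_right)
next
  case (add a a')
  then show ?case by (simp add: distrib_right free_act_plus)
qed

lemma free_act_1 [simp]: "free_act q p 1 f = f"
  using free_act_single[of q p 0 1 f] by simp

lemma free_act_gen: "free_act q p (free_gen s) f = gen_act q p s f"
  by (simp add: free_gen_def free_act_single word_act_def)

lemma free_act_poly_h: "free_act q p (free_poly_h g) f = g * f"
proof -
  have pow: "free_act q p (free_h ^ i) f = [:0, 1:] ^ i * f" for i
    by (induction i) (simp_all add: free_act_mult free_act_gen)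
  have "free_act q p (free_poly_h g) f =
      (\<Sum>i\<le>Polynomial.degree g. Polynomial.smult (Polynomial.coeff g i) ([:0, 1:] ^ i)) * f"
    by (simp add: free_poly_h_def free_act_sum free_act_mult free_act_single pow sum_distrib_right)
  also have "(\<Sum>i\<le>Polynomial.degree g. Polynomial.smult (Polynomial.coeff g i) ([:0, 1:] ^ i)) = g"
    by (simp add: poly_as_sum_of_monoms monom_altdef[symmetric])
  finally show ?thesis .
qed

lemma shift_down_up [simp]: "shift_down (shift_up f) = f"
  by (simp add: shift_up_def shift_down_def flip: pcompose_assoc) (simp add: pcompose_pCons)

lemma shift_up_down [simp]: "shift_up (shift_down f) = f"
  by (simp add: shift_up_def shift_down_def flip: pcompose_assoc) (simp add: pcompose_pCons)

lemma shift_mult [simp]: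
  "shift_up (f * f') = shift_up f * shift_up f'"
  "shift_down (f * f') = shift_down f * shift_down f'"
  by (simp_all add: shift_up_def shift_down_def pcompose_mult)

lemma free_act_relators:
  assumes "g = shift_down u - u" and "p * shift_down q = shift_down u + [:C:]"
    and "r \<in> smith_relators g"
  shows "free_act q p r f = 0"
proof -
  have "shift_up (p * shift_down q) = u + [:C:]"
    unfolding assms(2) by (simp add: shift_up_def shift_down_def pcompose_add flip: pcompose_assoc)
      (simp add: pcompose_pCons)
  then have up: "shift_up p * q = u + [:C:]" by simp
  have hd: "shift_down [:0, 1:] = [:0, 1:] - (1 :: 'a poly)"
    and hu: "shift_up [:0, 1:] = [:0, 1:] + (1 :: 'a poly)"
    by (simp_all add: shift_up_def shift_down_def pcompose_pCons one_pCons)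
  have g: "g = p * shift_down q - shift_up p * q"
    unfolding assms(1,2) up by simp
  from assms(3) consider
      "r = (free_h * free_y - free_y * free_h) - free_y"
    | "r = (free_h * free_x - free_x * free_h) + free_x"
    | "r = (free_y * free_x - free_x * free_y) - free_poly_h g"
    unfolding smith_relators_def by blast
  then show ?thesis
    by cases (simp_all only: free_act_diff free_act_plus free_act_mult free_act_gen gen_act.simps
        free_act_poly_h shift_mult hd hu shift_down_up shift_up_down g, simp_all add: algebra_simps)
qed

lemma p_poly_mult:
  fixes u :: "'k::{alg_closed_field, field_char_0} poly"
  assumes "X \<subseteq># proots (u + [:C:])"
  shows "p_poly u C X * shift_down (q_poly X) = shift_down u + [:C:]"
proof (cases "u + [:C:] = 0")
  case True
  then have "shift_down (u + [:C:]) = 0" by (simp add: shift_down_def)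
  then show ?thesis by (simp add: p_poly_def shift_down_def pcompose_add)
next
  case False
  obtain A where A: "u + [:C:] = Polynomial.smult (lead_coeff (u + [:C:])) (\<Prod>x\<in>#A. [:-x, 1:])"
    using alg_closed_imp_factorization[OF False] by blast
  have "proots (u + [:C:]) = A"
  proof -
    have "proots (\<Prod>x\<in>#A. [:-x, 1:]) = A" for A :: "'k multiset"
    proof (induction A)
      case (add x A)
      have "[:-x, 1:] * (\<Prod>x\<in>#A. [:-x, 1:]) \<noteq> 0"
        by (auto simp del: mult_pCons_left simp: prod_mset_zero_iff)
      then show ?case
        using proots_mult[of "[:-x, 1:]" "\<Prod>x\<in>#A. [:-x, 1:]"] add.IH
        by (simp del: mult_pCons_left)
    qed simp
    with False A show ?thesis by (metis proots_smult leading_coeff_0_iff)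
  qed
  with assms have "q_poly X dvd (\<Prod>x\<in>#A. [:-x, 1:])"
    unfolding q_poly_def by (intro prod_mset_subset_imp_dvd image_mset_subseteq_mono) simp
  then have "q_poly X dvd u + [:C:]"
    by (subst A) (rule dvd_smult)
  then have "shift_down (q_poly X) dvd shift_down (u + [:C:])"
    by (auto elim!: dvdE)
  then show ?thesis
    by (simp add: p_poly_def shift_down_def pcompose_add)
qed

lemma ring_free_alg: "ring (free_alg :: (smith_word \<Rightarrow>\<^sub>0 'k::field) ring)"
proof -
  have "\<exists>b. b + a = 0 \<and> a + b = 0" for a :: "smith_word \<Rightarrow>\<^sub>0 'k"
    by (rule exI[of _ "- a"]) simp
  then show ?thesis
    unfolding free_alg_def by unfold_locales (auto simp: algebra_simps Units_def)
qed

lemma ideal_smith_ideal: "ideal (smith_ideal g) (free_alg :: (smith_word \<Rightarrow>\<^sub>0 'k::field) ring)"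
  unfolding smith_ideal_def
  by (rule ring.genideal_ideal[OF ring_free_alg]) (simp add: free_alg_def)

lemma free_act_smith_ideal:
  fixes u :: "'k::field poly"
  assumes "g = shift_down u - u" and "p * shift_down q = shift_down u + [:C:]"
    and a: "a \<in> smith_ideal g"
  shows "free_act q p a f = 0"
proof -
  interpret F: ring "free_alg :: (smith_word \<Rightarrow>\<^sub>0 'k) ring" by (rule ring_free_alg)
  let ?K = "{a. \<forall>f. free_act q p a f = 0}"
  have inv: "\<ominus>\<^bsub>free_alg\<^esub> a = - a" for a :: "smith_word \<Rightarrow>\<^sub>0 'k"
    by (rule F.minus_equality) (simp_all add: free_alg_def)
  have "ideal ?K free_alg"
  proof (rule idealI[OF ring_free_alg])
    show "subgroup ?K (add_monoid free_alg)"
      by (rule subgroup.intro)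
         (auto simp: free_act_plus free_alg_def free_act_minus
            inv[unfolded a_inv_def free_alg_def, simplified])
  qed (auto simp: free_alg_def free_act_mult free_act_def[of _ _ _ 0] word_act_smult[of _ _ _ 0 0, simplified])
  moreover have "smith_relators g \<subseteq> ?K"
    using free_act_relators[OF assms(1,2)] by blast
  ultimately have "smith_ideal g \<subseteq> ?K"
    unfolding smith_ideal_def by (rule F.genideal_minimal)
  with a show ?thesis by blast
qed

lemma free_alg_coset: "smith_ideal g +>\<^bsub>free_alg\<^esub> a = (\<lambda>i. i + a) ` smith_ideal g"
  by (auto simp: a_r_coset_def r_coset_def free_alg_def)

lemma carrier_smith_algebra:
  "carrier (smith_algebra g) = range (\<lambda>a. smith_ideal g +>\<^bsub>free_alg\<^esub> a)"
proof -
  have "carrier (smith_algebra g) = (\<Union>a\<in>carrier free_alg. {smith_ideal g +>\<^bsub>free_alg\<^esub> a})"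
    by (simp add: smith_algebra_def FactRing_def A_RCOSETS_def RCOSETS_def a_r_coset_def)
  then show ?thesis by (auto simp: free_alg_def)
qed

lemma A_mod_smult_coset:
  fixes u :: "'k::{alg_closed_field, field_char_0} poly"
  assumes "g = shift_down u - u" and "X \<subseteq># proots (u + [:C:])"
  shows "(smith_ideal g +>\<^bsub>free_alg\<^esub> a) \<odot>\<^bsub>A_mod u C X\<^esub> f
    = free_act (q_poly X) (p_poly u C X) a f"
proof -
  have "0 \<in> smith_ideal g"
    using additive_subgroup.zero_closed[OF ideal.axioms(1)[OF ideal_smith_ideal[of g]]]
    by (simp add: free_alg_def)
  then have "(\<lambda>b. free_act (q_poly X) (p_poly u C X) b f) ` (smith_ideal g +>\<^bsub>free_alg\<^esub> a)
      = {free_act (q_poly X) (p_poly u C X) a f}"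
    using free_act_smith_ideal[OF assms(1) p_poly_mult[OF assms(2)], of _ f]
    by (force simp: free_alg_coset free_act_plus)
  then show ?thesis by (simp add: A_mod_def)
qed

theorem A_mod_left_module:
  fixes u :: "'k::{alg_closed_field, field_char_0} poly"
  assumes g: "g = shift_down u - u" and X: "X \<subseteq># proots (u + [:C:])"
  shows "left_module (smith_algebra g) (A_mod u C X)"
proof -
  let ?S = "smith_algebra g" and ?M = "A_mod u C X"
  let ?c = "\<lambda>a. smith_ideal g +>\<^bsub>free_alg\<^esub> a"
  interpret I: ideal "smith_ideal g" free_alg by (rule ideal_smith_ideal)
  note act = A_mod_smult_coset[OF g X]
  have plus: "?c a \<oplus>\<^bsub>?S\<^esub> ?c b = ?c (a + b)" for a b
    using I.a_rcos_sum[of a b] by (simp add: smith_algebra_def FactRing_def free_alg_def)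
  have mult: "?c a \<otimes>\<^bsub>?S\<^esub> ?c b = ?c (a * b)" for a b
    using I.rcoset_mult_add[of a b] by (simp add: smith_algebra_def FactRing_def free_alg_def)
  have one: "\<one>\<^bsub>?S\<^esub> = ?c 1"
    by (simp add: smith_algebra_def FactRing_def free_alg_def)
  have "ring ?S"
    unfolding smith_algebra_def by (rule I.quotient_is_ring)
  moreover have "abelian_group ?M"
  proof -
    have "\<exists>b. b + a = 0 \<and> a + b = 0" for a :: "'k poly"
      by (rule exI[of _ "- a"]) simp
    then show ?thesis
      unfolding A_mod_def by unfold_locales (auto simp: algebra_simps Units_def)
  qed
  moreover have "left_module_axioms ?S ?M"
    unfolding left_module_axioms_def carrier_smith_algebra
    by (auto simp: plus mult one act free_act_plus free_act_mult free_act_add_right)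
       (auto simp: A_mod_def free_act_plus free_act_mult free_act_add_right)
  ultimately show ?thesis
    by (rule left_module.intro)
qed

end

theory Submission
  imports Defs
begin

text \<open>
  A submodule of \<open>A\<^sub>C(X)\<close> is stable under multiplication by \<open>h\<close>, so it is an ideal \<open>(b)\<close> of
  \<open>k[h]\<close>, and if it is nonzero it is determined by the function \<open>B(\<alpha>) = ord\<^sub>\<alpha> b\<close>. Put
  \<open>R = R\<^bsub>u + C\<^esub>\<close> and \<open>Y = R - X\<close>. Comparing orders in \<open>b | b(h + 1) q\<close> (stability under \<open>x\<close>) and
  \<open>b | b(h - 1) p\<close> (stability under \<open>y\<close>) yields
  \<open>B(\<alpha>) \<le> B(\<alpha> + 1) + X(\<alpha>)\<close> and \<open>B(\<alpha> + 1) \<le> B(\<alpha>) + Y(\<alpha>)\<close> (\<open>stable_generator_orders\<close>).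
  Walking along \<open>\<alpha> + \<int>\<close>, the function \<open>B\<close> climbs by at most \<open>Y(\<alpha>)\<close> and falls by at most \<open>X(\<alpha>)\<close>
  between \<open>\<alpha>\<close> and \<open>\<alpha> + 1\<close>, and it vanishes far away in both directions.

  This has two consequences. First, \<open>B\<close> can change only right after a point of \<open>R\<close>, so it is determined
  by its values on \<open>R\<close>; hence the sum of \<open>B(\<alpha>)\<close> over the distinct roots \<open>\<alpha>\<close> drops strictly when the
  submodule grows (\<open>critical_order_sum_strict\<close>). Summing over all \<open>\<alpha>\<close> would also be strictly monotone, but
  it is far too large, as \<open>B\<close> is constant on long intervals. Second, \<open>B(\<alpha>)\<close> is at most the number of
  elements of \<open>Y\<close> below \<open>\<alpha>\<close>, and at most the number of elements of \<open>X\<close> at or above \<open>\<alpha>\<close>.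

  It remains to see that the sum over the distinct \<open>\<alpha> \<in> R\<close> of the smaller of these two numbers is at most
  \<open>\<ell>(X)\<close>, the number of inversions, that is, of pairs in \<open>Y \<times> X\<close> whose first entry is strictly
  below the second (\<open>sum_min_le_inversions\<close>). Read as a word in the
  letters \<open>X\<close> and \<open>Y\<close>, a chain of roots is the boundary path of a Young diagram whose cells are the
  inversions; a point of the path with \<open>y\<close> letters \<open>Y\<close> before it and \<open>x\<close> letters \<open>X\<close> after it lies
  on a diagonal with \<open>min y x\<close> cells, and different points lie on different diagonals.

  So a strict chain contains at most \<open>\<ell>(X) + 1\<close> nonzero submodules, and its length is at most
  \<open>\<ell>(X) + 1\<close> because it may start with the zero submodule.
\<close>

section \<open>Counting inversions along chains\<close>

context order
begin

text \<open>Removing a minimal element \<open>m\<close> of \<open>Y\<close> lowers the right-hand side by the number of elements of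
  \<open>X\<close> above \<open>m\<close>. On the left, it lowers by one exactly the terms at those \<open>a > m\<close> for which the remaining
  number \<open>y a\<close> of smaller elements of \<open>Y\<close> is less than \<open>x a\<close>. These \<open>a\<close> form a chain; if \<open>t\<close> is the
  largest of them, then the others lie strictly between \<open>m\<close> and \<open>t\<close>, where there are at most \<open>y t < x t\<close>
  elements of \<open>Y\<close>. So the \<open>x t\<close> elements of \<open>X\<close> at or above \<open>t\<close>, together with those between
  \<open>m\<close> and \<open>t\<close>, suffice to pay for all of them.\<close>

lemma sum_min_le_inversions:
  fixes X Y :: "'a multiset"
  assumes chain: "\<And>c a b. c < a \<Longrightarrow> c < b \<Longrightarrow> a \<le> b \<or> b \<le> a"
  shows "(\<Sum>a\<in>set_mset (X + Y). min (size {#b \<in># Y. b < a#}) (size {#b \<in># X. a \<le> b#}))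
    \<le> (\<Sum>b\<in>#X. size {#a \<in># Y. a < b#})"
proof (induction "size Y" arbitrary: Y)
  case 0
  then show ?case by simp
next
  case (Suc n)
  then have "set_mset Y \<noteq> {}" by auto
  then obtain m where m: "m \<in># Y" and min: "\<And>b. b \<in># Y \<Longrightarrow> \<not> b < m"
    using finite_has_minimal[of "set_mset Y"] by (force simp: less_le)
  define Y' where "Y' = Y - {#m#}"
  have Y: "Y = add_mset m Y'" using m by (simp add: Y'_def)
  define x where "x a = size {#b \<in># X. a \<le> b#}" for a
  define y where "y a = size {#b \<in># Y'. b < a#}" for a
  define T where "T = {a \<in> set_mset (X + Y'). m < a \<and> y a < x a}"
  have inv: "(\<Sum>b\<in>#X. size {#a \<in># Y. a < b#})
      = (\<Sum>b\<in>#X. size {#a \<in># Y'. a < b#}) + size {#b \<in># X. m < b#}"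
    by (induction X) (simp_all add: Y)
  have "card T \<le> size {#b \<in># X. m < b#}"
  proof (cases "T = {}")
    case False
    then obtain t where t: "t \<in> T" and max: "\<And>a. a \<in> T \<Longrightarrow> \<not> t < a"
      using finite_has_maximal[of T] by (force simp: T_def less_le)
    define I where "I = {#b \<in># X + Y'. m < b \<and> b < t#}"
    have "T \<subseteq> insert t (set_mset I)"
    proof
      fix a assume a: "a \<in> T"
      with t have "a \<le> t \<or> t \<le> a" by (auto simp: T_def dest: chain[of m a t])
      with max[OF a] a show "a \<in> insert t (set_mset I)"
        by (auto simp: T_def I_def le_less)
    qed
    then have "card T \<le> Suc (card (set_mset I))"
      using card_mono[of "insert t (set_mset I)" T] by (simp add: card_insert_if split: if_splits)
    also have "card (set_mset I) \<le> size I"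
      by (induction I) (auto simp: card_insert_if)
    also have "size I \<le> size {#b \<in># X. m < b \<and> b < t#} + y t"
      unfolding I_def y_def by (induction Y') auto
    also have "Suc (size {#b \<in># X. m < b \<and> b < t#} + y t) \<le> size {#b \<in># X. m < b \<and> b < t#} + x t"
      using t by (simp add: T_def)
    also have "\<dots> \<le> size {#b \<in># X. m < b#}"
      unfolding x_def using t by (induction X) (auto simp: T_def intro: less_le_trans)
    finally show ?thesis by simp
  qed simp
  \<comment> \<open>The index set can lose only \<open>m\<close>, whose term is zero since \<open>m\<close> is minimal in \<open>Y\<close>.\<close>
  have "(\<Sum>a\<in>set_mset (X + Y). min (size {#b \<in># Y. b < a#}) (x a))
      = (\<Sum>a\<in>set_mset (X + Y'). min (size {#b \<in># Y. b < a#}) (x a))"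
  proof (rule sum.mono_neutral_right)
    have "{#b \<in># Y. b < m#} = {#}" using min by (auto intro!: multiset_eqI simp: not_in_iff)
    moreover have "set_mset (X + Y) - set_mset (X + Y') \<subseteq> {m}" by (auto simp: Y)
    ultimately show "\<forall>a\<in>set_mset (X + Y) - set_mset (X + Y').
        min (size {#b \<in># Y. b < a#}) (x a) = 0" by (metis min_0L singletonD size_empty subsetD)
  qed (auto simp: Y)
  also have "\<dots> = (\<Sum>a\<in>set_mset (X + Y'). min (y a) (x a) + (if a \<in> T then 1 else 0))"
    by (rule sum.cong) (auto simp: Y T_def y_def)
  also have "\<dots> = (\<Sum>a\<in>set_mset (X + Y'). min (y a) (x a)) + card T"
    by (simp add: sum.distrib T_def flip: sum.inter_filter)
  also have "\<dots> \<le> (\<Sum>b\<in>#X. size {#a \<in># Y'. a < b#}) + size {#b \<in># X. m < b#}"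
    using Suc.hyps(1)[of Y'] Suc.hyps(2) \<open>card T \<le> _\<close>
    by (intro add_mono) (auto simp: Y x_def y_def)
  finally show ?case by (simp add: inv x_def)
qed

end

section \<open>Integer-spaced roots and functions with bounded jumps\<close>

lemma class_order_root: "class.order root_le (root_less :: 'k::field_char_0 \<Rightarrow> _)"
proof
  fix a b c :: 'k
  have anti: "a = b" if "root_le a b" "root_le b a"
  proof -
    from that obtain m n :: nat where "b - a = of_nat m" "a - b = of_nat n"
      by (auto simp: root_le_def)
    moreover have "(b - a) + (a - b) = 0" by simp
    ultimately have "of_nat (m + n) = (0 :: 'k)" by simp
    then have "m = 0" by (simp only: of_nat_eq_0_iff add_is_0)
    with \<open>b - a = of_nat m\<close> show ?thesis by simp
  qed
  show "root_less a b \<longleftrightarrow> root_le a b \<and> \<not> root_le b a"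
    using anti by (auto simp: root_less_def)
  show "root_le a a" by (auto simp: root_le_def intro: exI[of _ 0])
  show "root_le a c" if "root_le a b" "root_le b c"
  proof -
    from that obtain m n :: nat where "b - a = of_nat m" "c - b = of_nat n"
      by (auto simp: root_le_def)
    then have "c - a = of_nat (m + n)" by (simp add: algebra_simps)
    then show ?thesis unfolding root_le_def by blast
  qed
  show "root_le a b \<Longrightarrow> root_le b a \<Longrightarrow> a = b" by (rule anti)
qed

lemma root_le_add_1_iff: "root_le \<alpha> \<beta> \<longleftrightarrow> \<beta> = \<alpha> \<or> root_le (\<alpha> + 1) \<beta>"
proof
  assume "root_le \<alpha> \<beta>"
  then obtain n :: nat where n: "\<beta> - \<alpha> = of_nat n" by (auto simp: root_le_def)
  show "\<beta> = \<alpha> \<or> root_le (\<alpha> + 1) \<beta>"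
  proof (cases n)
    case (Suc k)
    with n have "\<beta> - (\<alpha> + 1) = of_nat k" by (simp add: algebra_simps)
    then show ?thesis unfolding root_le_def by blast
  qed (use n in simp)
next
  assume "\<beta> = \<alpha> \<or> root_le (\<alpha> + 1) \<beta>"
  then consider "\<beta> = \<alpha>" | n :: nat where "\<beta> - (\<alpha> + 1) = of_nat n" by (auto simp: root_le_def)
  then show "root_le \<alpha> \<beta>"
  proof cases
    case 1
    then show ?thesis by (auto simp: root_le_def intro: exI[of _ 0])
  next
    case 2
    then have "\<beta> - \<alpha> = of_nat (Suc n)" by (simp add: algebra_simps)
    then show ?thesis unfolding root_le_def by blast
  qed
qed

lemma not_root_le_add_1: "\<not> root_le (\<alpha> + 1) \<alpha>"
proof
  assume "root_le (\<alpha> + 1) \<alpha>"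
  then obtain n :: nat where "\<alpha> - (\<alpha> + 1) = of_nat n" by (auto simp: root_le_def)
  moreover have "(\<alpha> - (\<alpha> + 1)) + 1 = 0" by simp
  ultimately have "of_nat (Suc n) = (0 :: 'a)" by (simp add: add.commute)
  then show False by (simp only: of_nat_eq_0_iff)
qed

lemma root_less_add_1_iff: "root_less \<alpha> (\<beta> + 1) \<longleftrightarrow> \<alpha> = \<beta> \<or> root_less \<alpha> \<beta>"
proof -
  have "root_less \<alpha> (\<beta> + 1) \<longleftrightarrow> root_le (\<alpha> + 1) (\<beta> + 1)"
    using root_le_add_1_iff[of \<alpha> "\<beta> + 1"] not_root_le_add_1[of \<alpha>] by (auto simp: root_less_def)
  also have "\<dots> \<longleftrightarrow> root_le \<alpha> \<beta>" by (simp add: root_le_def)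
  also have "\<dots> \<longleftrightarrow> \<alpha> = \<beta> \<or> root_less \<alpha> \<beta>"
    by (auto simp: root_less_def root_le_def intro: exI[of _ 0])
  finally show ?thesis .
qed

lemma root_chain:
  assumes "root_less \<gamma> \<alpha>" "root_less \<gamma> \<beta>"
  shows "root_le \<alpha> \<beta> \<or> root_le \<beta> \<alpha>"
proof -
  from assms obtain m n :: nat where "\<alpha> - \<gamma> = of_nat m" "\<beta> - \<gamma> = of_nat n"
    by (auto simp: root_le_def root_less_def)
  then have "m \<le> n \<Longrightarrow> \<beta> - \<alpha> = of_nat (n - m)" "n \<le> m \<Longrightarrow> \<alpha> - \<beta> = of_nat (m - n)"
    by (simp_all add: of_nat_diff algebra_simps)
  then show ?thesis unfolding root_le_def by (meson nle_le)
qed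

text \<open>In characteristic zero, a ray \<open>\<alpha> + \<nat> s\<close> consists of distinct points.\<close>

lemma ray_leaves_finite_set:
  fixes \<alpha> s :: "'k::field_char_0"
  assumes "finite S" and "s \<noteq> 0"
  obtains n :: nat where "\<alpha> + of_nat n * s \<notin> S"
proof -
  have "inj (\<lambda>n::nat. \<alpha> + of_nat n * s)" using assms by (auto intro: injI)
  then have "\<not> range (\<lambda>n::nat. \<alpha> + of_nat n * s) \<subseteq> S"
    using assms(1) finite_subset range_inj_infinite by blast
  with that show ?thesis by blast
qed

lemma size_filter_eq: "size {#x \<in># M. x = a#} = count M a"
  by (induction M) auto

text \<open>Going up from \<open>\<alpha>\<close> in unit steps, \<open>f\<close> must come down to \<open>0\<close>, and the descent at each point is paid
  for by the elements of \<open>X\<close> there.\<close>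

lemma descent_bound_above:
  fixes f :: "'k::field_char_0 \<Rightarrow> nat"
  assumes "finite {\<alpha>. f \<alpha> \<noteq> 0}" and step: "\<And>\<alpha>. f \<alpha> \<le> f (\<alpha> + 1) + count X \<alpha>"
  shows "f \<alpha> \<le> size {#\<beta> \<in># X. root_le \<alpha> \<beta>#}"
proof -
  have split: "size {#\<beta> \<in># X. root_le \<alpha> \<beta>#} = count X \<alpha> + size {#\<beta> \<in># X. root_le (\<alpha> + 1) \<beta>#}" for \<alpha>
  proof -
    have "size {#\<beta> \<in># X. root_le \<alpha> \<beta>#}
        = size {#\<beta> \<in># X. \<beta> = \<alpha>#} + size {#\<beta> \<in># X. root_le (\<alpha> + 1) \<beta>#}"
      by (induction X) (auto simp: root_le_add_1_iff[of \<alpha>] not_root_le_add_1)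
    then show ?thesis by (simp add: size_filter_eq)
  qed
  obtain n :: nat where "f (\<alpha> + of_nat n) = 0"
    using ray_leaves_finite_set[OF assms(1), of 1 \<alpha>] by auto
  then show ?thesis
  proof (induction n arbitrary: \<alpha>)
    case (Suc n)
    then have "f (\<alpha> + 1) \<le> size {#\<beta> \<in># X. root_le (\<alpha> + 1) \<beta>#}" by (simp add: add.assoc)
    with step[of \<alpha>] show ?case by (simp add: split[of \<alpha>])
  qed simp
qed

text \<open>The mirror image: coming from below, \<open>f\<close> has to rise from \<open>0\<close>. The inequality is strict
  because the elements of \<open>Y\<close> at \<open>\<alpha>\<close> act only on the step from \<open>\<alpha>\<close> to \<open>\<alpha> + 1\<close>.\<close>

lemma ascent_bound_below:
  fixes f :: "'k::field_char_0 \<Rightarrow> nat"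
  assumes "finite {\<alpha>. f \<alpha> \<noteq> 0}" and step: "\<And>\<alpha>. f (\<alpha> + 1) \<le> f \<alpha> + count Y \<alpha>"
  shows "f \<alpha> \<le> size {#\<beta> \<in># Y. root_less \<beta> \<alpha>#}"
proof -
  have irrefl: "\<not> root_less \<alpha> \<alpha>" for \<alpha> :: 'k by (simp add: root_less_def)
  have split: "size {#\<beta> \<in># Y. root_less \<beta> (\<alpha> + 1)#} = count Y \<alpha> + size {#\<beta> \<in># Y. root_less \<beta> \<alpha>#}" for \<alpha>
  proof -
    have "size {#\<beta> \<in># Y. root_less \<beta> (\<alpha> + 1)#}
        = size {#\<beta> \<in># Y. \<beta> = \<alpha>#} + size {#\<beta> \<in># Y. root_less \<beta> \<alpha>#}"
      by (induction Y) (auto simp: root_less_add_1_iff irrefl)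
    then show ?thesis by (simp add: size_filter_eq)
  qed
  obtain n :: nat where "f (\<alpha> - of_nat n) = 0"
    using ray_leaves_finite_set[OF assms(1), of "-1" \<alpha>] by auto
  then show ?thesis
  proof (induction n arbitrary: \<alpha>)
    case (Suc n)
    then have "f (\<alpha> - 1) \<le> size {#\<beta> \<in># Y. root_less \<beta> (\<alpha> - 1)#}" by (simp add: algebra_simps)
    with step[of "\<alpha> - 1"] split[of "\<alpha> - 1"] show ?case by simp
  qed simp
qed

text \<open>From any point, go up to the next point of \<open>S\<close> without changing either value; if there is none,
  both values are \<open>0\<close>, since both functions vanish far up.\<close>

lemma eq_if_eq_on_jumps:
  fixes f f' :: "'k::field_char_0 \<Rightarrow> nat"
  assumes "finite {\<alpha>. f \<alpha> \<noteq> 0}" and "finite {\<alpha>. f' \<alpha> \<noteq> 0}"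
    and "\<And>\<alpha>. \<alpha> \<notin> S \<Longrightarrow> f (\<alpha> + 1) = f \<alpha>" and "\<And>\<alpha>. \<alpha> \<notin> S \<Longrightarrow> f' (\<alpha> + 1) = f' \<alpha>"
    and eq: "\<And>\<alpha>. \<alpha> \<in> S \<Longrightarrow> f \<alpha> = f' \<alpha>"
  shows "f = f'"
proof
  fix \<alpha>
  obtain n :: nat where "f (\<alpha> + of_nat n) = 0 \<and> f' (\<alpha> + of_nat n) = 0"
    using ray_leaves_finite_set[OF finite_UnI[OF assms(1,2)], of 1 \<alpha>] by auto
  then show "f \<alpha> = f' \<alpha>"
  proof (induction n arbitrary: \<alpha>)
    case (Suc n)
    then have "f (\<alpha> + 1) = f' (\<alpha> + 1)" by (simp add: add.assoc)
    then show ?case using assms(3,4) eq by (cases "\<alpha> \<in> S") auto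
  qed simp
qed

section \<open>Orders of vanishing of generators of submodules\<close>

lemma shift_up_dvd_iff: "shift_up a dvd shift_up b \<longleftrightarrow> a dvd b"
  by (metis dvd_def shift_down_up shift_mult(1) shift_mult(2))

lemma shift_up_eq_0_iff [simp]: "shift_up f = 0 \<longleftrightarrow> f = 0"
  by (metis shift_down_up shift_up_def pcompose_0)

lemma shift_down_eq_0_iff [simp]: "shift_down f = 0 \<longleftrightarrow> f = 0"
  by (metis shift_down_up shift_up_down shift_up_eq_0_iff)

lemma order_shift_up:
  fixes f :: "'k::field poly"
  assumes "f \<noteq> 0"
  shows "Polynomial.order \<alpha> (shift_up f) = Polynomial.order (\<alpha> + 1) f"
proof -
  have "[:-\<alpha>, 1:] = shift_up [:-(\<alpha> + 1), 1:]"
    by (simp add: shift_up_def pcompose_pCons)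
  moreover have "shift_up a ^ n = shift_up (a ^ n)" for a :: "'k poly" and n
    by (induction n) (simp_all add: shift_up_def pcompose_mult pcompose_1)
  ultimately have dvd_iff: "[:-\<alpha>, 1:] ^ n dvd shift_up f \<longleftrightarrow> [:-(\<alpha> + 1), 1:] ^ n dvd f" for n
    by (metis shift_up_dvd_iff)
  show ?thesis
    using Polynomial.order[OF assms, of "\<alpha> + 1"]
    by (intro order_unique_lemma; unfold dvd_iff; blast)
qed

lemma order_shift_down:
  fixes f :: "'k::field poly"
  assumes "f \<noteq> 0"
  shows "Polynomial.order (\<alpha> + 1) (shift_down f) = Polynomial.order \<alpha> f"
  using order_shift_up[of "shift_down f" \<alpha>] assms by simp

lemma q_poly_nonzero [simp]: "q_poly X \<noteq> 0"
  by (auto simp: q_poly_def prod_mset_zero_iff)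

lemma order_q_poly: "Polynomial.order \<alpha> (q_poly X) = count X \<alpha>"
proof (induction X)
  case empty
  show ?case by (simp add: q_poly_def order_0I)
next
  case (add x X)
  have "Polynomial.order \<alpha> (q_poly (add_mset x X))
      = Polynomial.order \<alpha> [:-x, 1:] + Polynomial.order \<alpha> (q_poly X)"
  proof -
    have "q_poly (add_mset x X) = [:-x, 1:] * q_poly X" by (simp add: q_poly_def)
    then show ?thesis by (metis order_mult q_poly_nonzero)
  qed
  moreover have "Polynomial.order \<alpha> [:-x, 1:] = (if x = \<alpha> then 1 else 0)"
    using order_power_n_n[of x 1] by (auto intro: order_0I)
  ultimately show ?case using add by simp
qed

text \<open>The two divisibilities say that the ideal generated by \<open>b\<close> is stable under \<open>x\<close> and under \<open>y\<close>:
  the shifts are ring automorphisms, so it is enough to test the generator.\<close>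

definition stable_generator :: "'k::field poly \<Rightarrow> 'k poly \<Rightarrow> 'k poly \<Rightarrow> bool" where
  "stable_generator q p b \<longleftrightarrow> b \<noteq> 0 \<and> b dvd shift_up b * q \<and> b dvd shift_down b * p"

text \<open>Since \<open>p(h) q(h - 1) = u(h - 1) + C\<close>, the roots of \<open>p\<close> are those of \<open>u + C\<close> outside \<open>X\<close>,
  moved up by one; the roots of \<open>q\<close> are \<open>X\<close>. So both bounds follow by comparing orders in the
  divisibilities that express stability.\<close>

lemma stable_generator_orders:
  fixes u :: "'k::{alg_closed_field, field_char_0} poly"
  assumes u: "u + [:C:] \<noteq> 0" and X: "X \<subseteq># proots (u + [:C:])"
    and b: "stable_generator (q_poly X) (p_poly u C X) b"
  shows "Polynomial.order \<alpha> b \<le> Polynomial.order (\<alpha> + 1) b + count X \<alpha>"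
    and "Polynomial.order (\<alpha> + 1) b \<le> Polynomial.order \<alpha> b + count (proots (u + [:C:]) - X) \<alpha>"
proof -
  let ?q = "q_poly X" and ?p = "p_poly u C X"
  have b0: "b \<noteq> 0" using b by (simp add: stable_generator_def)
  have pq: "?p * shift_down ?q = shift_down (u + [:C:])"
    using p_poly_mult[OF X] by (simp add: shift_down_def pcompose_add)
  have p0: "?p \<noteq> 0"
    using pq u by (metis mult_zero_left shift_down_eq_0_iff)
  have "Polynomial.order (\<alpha> + 1) ?p + count X \<alpha> = count (proots (u + [:C:])) \<alpha>"
    using order_mult[of ?p "shift_down ?q" "\<alpha> + 1"] pq p0 u
    by (simp add: order_shift_down order_q_poly)
  then have p: "Polynomial.order (\<alpha> + 1) ?p = count (proots (u + [:C:]) - X) \<alpha>"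
    by simp
  have "Polynomial.order \<alpha> b \<le> Polynomial.order \<alpha> (shift_up b * ?q)"
    using b by (intro dvd_imp_order_le) (auto simp: stable_generator_def)
  also have "\<dots> = Polynomial.order (\<alpha> + 1) b + count X \<alpha>"
    using b0 by (subst order_mult) (auto simp: order_shift_up order_q_poly)
  finally show "Polynomial.order \<alpha> b \<le> Polynomial.order (\<alpha> + 1) b + count X \<alpha>" .
  have "Polynomial.order (\<alpha> + 1) b \<le> Polynomial.order (\<alpha> + 1) (shift_down b * ?p)"
    using b p0 by (intro dvd_imp_order_le) (auto simp: stable_generator_def)
  also have "\<dots> = Polynomial.order \<alpha> b + count (proots (u + [:C:]) - X) \<alpha>"
    using b0 p0 by (subst order_mult) (auto simp: order_shift_down p)
  finally show "Polynomial.order (\<alpha> + 1) b \<le> Polynomial.order \<alpha> b + count (proots (u + [:C:]) - X) \<alpha>" .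
qed

lemma finite_order_support:
  fixes b :: "'k::field poly"
  assumes "b \<noteq> 0"
  shows "finite {\<alpha>. Polynomial.order \<alpha> b \<noteq> 0}"
  using poly_roots_finite[OF assms] by (rule rev_finite_subset) (use assms in \<open>auto simp: order_root\<close>)

lemma dvd_if_equal_orders:
  fixes b b' :: "'k::alg_closed_field poly"
  assumes "b' dvd b" "b \<noteq> 0" and eq: "\<And>\<alpha>. Polynomial.order \<alpha> b' = Polynomial.order \<alpha> b"
  shows "b dvd b'"
proof -
  obtain c where c: "b = b' * c" using assms(1) by blast
  have "poly c \<alpha> \<noteq> 0" for \<alpha>
    using order_mult[of b' c \<alpha>] eq[of \<alpha>] assms(2) c by (auto simp: order_root)
  then have "Polynomial.degree c = 0"
    using alg_closed_imp_poly_has_root[of c] by blast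
  then have "is_unit c"
    using assms(2) c by (auto simp: is_unit_iff_degree)
  with c show ?thesis by simp
qed

section \<open>A strictly monotone potential bounded by \<open>\<ell>(X)\<close>\<close>

text \<open>Each distinct root of \<open>u + C\<close> counts once here, whatever its multiplicity: \<open>ord\<^sub>\<alpha> b\<close> is constant
  in unit steps between consecutive roots, so one sample per root suffices.\<close>

definition critical_order_sum :: "'k::field poly \<Rightarrow> 'k \<Rightarrow> 'k poly \<Rightarrow> nat" where
  "critical_order_sum u C b = (\<Sum>\<alpha>\<in>set_mset (proots (u + [:C:])). Polynomial.order \<alpha> b)"

lemma critical_order_sum_le_ell:
  fixes u :: "'k::{alg_closed_field, field_char_0} poly"
  assumes u: "u + [:C:] \<noteq> 0" and X: "X \<subseteq># proots (u + [:C:])"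
    and b: "stable_generator (q_poly X) (p_poly u C X) b"
  shows "critical_order_sum u C b \<le> ell u C X"
proof -
  interpret root: order root_le "root_less :: 'k \<Rightarrow> _" by (rule class_order_root)
  let ?Y = "proots (u + [:C:]) - X"
  have b0: "b \<noteq> 0" using b by (simp add: stable_generator_def)
  note orders = stable_generator_orders[OF u X b]
  have R: "proots (u + [:C:]) = X + ?Y" using X by simp
  have "critical_order_sum u C b \<le> (\<Sum>\<alpha>\<in>set_mset (X + ?Y).
      min (size {#\<beta> \<in># ?Y. root_less \<beta> \<alpha>#}) (size {#\<beta> \<in># X. root_le \<alpha> \<beta>#}))"
    unfolding critical_order_sum_def R[symmetric]
    using ascent_bound_below[OF finite_order_support[OF b0] orders(2)]
      descent_bound_above[OF finite_order_support[OF b0] orders(1)]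
    by (intro sum_mono) simp
  also have "\<dots> \<le> (\<Sum>\<beta>\<in>#X. size {#\<alpha> \<in># ?Y. root_less \<alpha> \<beta>#})"
    by (rule root.sum_min_le_inversions) (rule root_chain)
  finally show ?thesis by (simp add: ell_def)
qed

text \<open>If the sums agreed, the orders of \<open>b\<close> and its divisor \<open>b'\<close> would agree at the roots of
  \<open>u + C\<close>; as they jump only there, they would agree everywhere, and \<open>b\<close> and \<open>b'\<close> would be
  associated.\<close>

lemma critical_order_sum_strict:
  fixes u :: "'k::{alg_closed_field, field_char_0} poly"
  assumes u: "u + [:C:] \<noteq> 0" and X: "X \<subseteq># proots (u + [:C:])"
    and b: "stable_generator (q_poly X) (p_poly u C X) b"
    and b': "stable_generator (q_poly X) (p_poly u C X) b'"
    and dvd: "b' dvd b" and ndvd: "\<not> b dvd b'"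
  shows "critical_order_sum u C b' < critical_order_sum u C b"
proof (rule ccontr)
  let ?R = "proots (u + [:C:])"
  have b0: "b \<noteq> 0" "b' \<noteq> 0" using b b' by (simp_all add: stable_generator_def)
  have le: "Polynomial.order \<alpha> b' \<le> Polynomial.order \<alpha> b" for \<alpha>
    using dvd b0 by (intro dvd_imp_order_le) auto
  assume "\<not> critical_order_sum u C b' < critical_order_sum u C b"
  then have "critical_order_sum u C b' = critical_order_sum u C b"
    using sum_mono[of "set_mset ?R" "\<lambda>\<alpha>. Polynomial.order \<alpha> b'" "\<lambda>\<alpha>. Polynomial.order \<alpha> b"] le
    by (simp add: critical_order_sum_def)
  then have eq: "Polynomial.order \<alpha> b' = Polynomial.order \<alpha> b" if "\<alpha> \<in># ?R" for \<alpha>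
    unfolding critical_order_sum_def by (rule sum_mono_inv) (use le that in auto)
  have flat: "Polynomial.order (\<alpha> + 1) f = Polynomial.order \<alpha> f"
    if f: "stable_generator (q_poly X) (p_poly u C X) f" and "\<alpha> \<notin># ?R" for f \<alpha>
  proof -
    have "count ?R \<alpha> = 0" using that(2) by (simp only: not_in_iff)
    then have "count X \<alpha> = 0" "count (?R - X) \<alpha> = 0"
      using mset_subset_eq_count[OF X, of \<alpha>] by (simp_all del: count_proots)
    then show ?thesis using stable_generator_orders[OF u X f, of \<alpha>] by linarith
  qed
  have "(\<lambda>\<alpha>. Polynomial.order \<alpha> b') = (\<lambda>\<alpha>. Polynomial.order \<alpha> b)"
    by (rule eq_if_eq_on_jumps[where S = "set_mset ?R"])
       (use finite_order_support b0 flat b b' eq in auto)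
  then have "b dvd b'"
    by (intro dvd_if_equal_orders[OF dvd b0(1)]) (rule fun_cong)
  with ndvd show False ..
qed

section \<open>Chains of submodules\<close>

text \<open>Every polynomial in \<open>h\<close> comes from the Smith algebra and acts by multiplication, so a submodule is an ideal
  of the principal ideal domain \<open>k[h]\<close>.\<close>

lemma submodule_principal:
  fixes u :: "'k::{alg_closed_field, field_char_0} poly"
  assumes g: "g = shift_down u - u" and X: "X \<subseteq># proots (u + [:C:])"
    and N: "submodule N (smith_algebra g) (A_mod u C X)" and nz: "N \<noteq> {0}"
  obtains b where "stable_generator (q_poly X) (p_poly u C X) b" "N = {f. b dvd f}"
proof -
  interpret N: submodule N "smith_algebra g" "A_mod u C X" by (rule N)
  let ?act = "free_act (q_poly X) (p_poly u C X)"
  have act: "?act a f \<in> N" if "f \<in> N" for a f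
    using N.smult_closed[of "smith_ideal g +>\<^bsub>free_alg\<^esub> a" f] that A_mod_smult_coset[OF g X, of a f]
    by (simp add: carrier_smith_algebra)
  have mult: "c * f \<in> N" if "f \<in> N" for c f
    using act[OF that, of "free_poly_h c"] by (simp add: free_act_poly_h)
  have add: "f + f' \<in> N" if "f \<in> N" "f' \<in> N" for f f'
    using N.m_closed[OF that] by (simp add: A_mod_def)
  have zero: "0 \<in> N" using N.one_closed by (simp add: A_mod_def)
  obtain b where b: "b \<in> N" "b \<noteq> 0"
    and least: "\<And>f. f \<in> N \<Longrightarrow> f \<noteq> 0 \<Longrightarrow> Polynomial.degree b \<le> Polynomial.degree f"
  proof -
    obtain f where "f \<in> N \<and> f \<noteq> 0" using nz zero by blast
    then show ?thesis
      using ex_has_least_nat[of "\<lambda>f. f \<in> N \<and> f \<noteq> 0" f Polynomial.degree] that by blast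
  qed
  have "b dvd f" if "f \<in> N" for f
  proof (rule ccontr)
    assume "\<not> b dvd f"
    then have nonzero: "f mod b \<noteq> 0" by (simp add: dvd_eq_mod_eq_0)
    have "f mod b \<in> N"
      using add[OF that mult[OF b(1), of "- (f div b)"]] by (simp add: minus_div_mult_eq_mod)
    then have "Polynomial.degree b \<le> Polynomial.degree (f mod b)"
      using least nonzero by blast
    with degree_mod_less'[OF b(2) nonzero] show False by simp
  qed
  moreover have "f \<in> N" if "b dvd f" for f
    using mult[OF b(1), of "f div b"] by (simp only: dvd_div_mult_self[OF that])
  ultimately have eq: "N = {f. b dvd f}" by blast
  have "shift_up b * q_poly X \<in> N" "shift_down b * p_poly u C X \<in> N"
    using act[OF b(1), of free_x] act[OF b(1), of free_y] by (simp_all add: free_act_gen)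
  then have "stable_generator (q_poly X) (p_poly u C X) b"
    using b(2) by (simp add: stable_generator_def eq)
  then show ?thesis using eq by (rule that)
qed

text \<open>Only \<open>N 0\<close> can be the zero submodule, so \<open>N 1, \<dots>, N n\<close> have generators, along which the
  potential drops \<open>n - 1\<close> times from a value of at most \<open>\<ell>(X)\<close>.\<close>

lemma submodule_chain_length:
  fixes u :: "'k::{alg_closed_field, field_char_0} poly"
  assumes g: "g = shift_down u - u" and u: "u + [:C:] \<noteq> 0" and X: "X \<subseteq># proots (u + [:C:])"
    and sub: "\<And>i. i \<le> n \<Longrightarrow> submodule (N i) (smith_algebra g) (A_mod u C X)"
    and strict: "\<And>i. i < n \<Longrightarrow> N i \<subset> N (Suc i)"
  shows "n \<le> ell u C X + 1"
proof (cases n)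
  case (Suc m)
  have zero: "0 \<in> N i" if "i \<le> n" for i
    using subgroup.one_closed[OF submodule.axioms(1)[OF sub[OF that]]] by (simp add: A_mod_def)
  have "\<exists>b. stable_generator (q_poly X) (p_poly u C X) b \<and> N (Suc i) = {f. b dvd f}" if "i \<le> m" for i
  proof -
    have "N (Suc i) \<noteq> {0}" using strict[of i] zero[of i] that Suc by auto
    then show ?thesis using submodule_principal[OF g X sub[of "Suc i"]] that Suc by (metis Suc_le_mono)
  qed
  then obtain b where gen: "\<And>i. i \<le> m \<Longrightarrow> stable_generator (q_poly X) (p_poly u C X) (b i)"
    and N: "\<And>i. i \<le> m \<Longrightarrow> N (Suc i) = {f. b i dvd f}" by metis
  have "critical_order_sum u C (b i) + i \<le> critical_order_sum u C (b 0)" if "i \<le> m" for i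
    using that
  proof (induction i)
    case (Suc i)
    have "{f. b i dvd f} \<subset> {f. b (Suc i) dvd f}"
      using strict[of "Suc i"] N[of i] N[of "Suc i"] Suc.prems \<open>n = Suc m\<close> by simp
    then obtain f where "b (Suc i) dvd f" "\<not> b i dvd f" and sub: "{f. b i dvd f} \<subseteq> {f. b (Suc i) dvd f}"
      by blast
    then have "\<not> b i dvd b (Suc i)" using dvd_trans by blast
    moreover have "b (Suc i) dvd b i" using subsetD[OF sub, of "b i"] by simp
    ultimately have "critical_order_sum u C (b (Suc i)) < critical_order_sum u C (b i)"
      using Suc.prems by (intro critical_order_sum_strict[OF u X] gen) simp_all
    with Suc.IH Suc.prems show ?case by simp
  qed simp
  from this[of m] critical_order_sum_le_ell[OF u X gen[of 0]] Suc show ?thesis by simp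
qed simp

theorem proposition3p22:
  fixes g u :: "'k::{alg_closed_field, field_char_0} poly"
    and C :: 'k and X :: "'k multiset"
  assumes "g \<noteq> 0"
    and "g = pcompose u [:-1, 1:] - u"
    and "X \<subseteq># proots (u + [:C:])"
  shows "left_module (smith_algebra g) (A_mod u C X)
    \<and> module_length (smith_algebra g) (A_mod u C X) < \<infinity>
    \<and> module_length (smith_algebra g) (A_mod u C X) \<le> enat (ell u C X + 1)"
proof -
  have g: "g = shift_down u - u" using assms(2) by (simp add: shift_down_def)
  \<comment> \<open>If \<open>u\<close> were constant, then \<open>g\<close> would be zero.\<close>
  have u: "u + [:C:] \<noteq> 0"
  proof
    assume "u + [:C:] = 0"
    then have "u = [:-C:]" by (simp add: add_eq_0_iff2)
    with g assms(1) show False by (simp add: shift_down_def)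
  qed
  have len: "module_length (smith_algebra g) (A_mod u C X) \<le> enat (ell u C X + 1)"
    unfolding module_length_def
    by (rule SUP_least) (use submodule_chain_length[OF g u assms(3)] in auto)
  then have "module_length (smith_algebra g) (A_mod u C X) < \<infinity>"
    by (rule order.strict_trans1) simp
  with len A_mod_left_module[OF g assms(3)] show ?thesis by simp
qed

end
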